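(* Let $(\Omega,\mathcal F,P)$ be a nonatomic probability space, $E=L^0(\mathcal F,\mathbb R)$ endowed with the locally $L^0$-convex topology $\mathcal T_c$ induced by $|\cdot|$, and $$M=\{x\in E:\ \text{there exists a positive real number } m_x \text{ such that } x>m_x \text{ a.s. on }\Omega\}.$$ Then $\tilde I_A\{0\}\cap\tilde I_AM=\emptyset$ for all $A\in\mathcal F$ with $P(A)>0$. But for every $L^0$-convex, $L^0$-absorbent and $L^0$-balanced $\mathcal T_c$-neighborhood $U$ of $0$ there is $A_U\in\mathcal F$ with $P(A_U)>0$ such that $\tilde I_{A_U}U\cap\tilde I_{A_U}(M+U)\neq\emptyset$.
   Context: $L^0(\mathcal F,\mathbb R)$ is the algebra of (a.s.-equality) equivalence classes of real-valued $\mathcal F$-measurable random variables with the a.s. order; $L^0_{++}(\mathcal F)$ is the set of its elements that are $>0$ a.s. on $\Omega$; $\tilde I_A$ is the class of the indicator of $A$, and $\tilde I_AS=\{\tilde I_As:s\in S\}$. Nonatomic means $\mathcal F$ contains no $P$-atoms. A set $G\subset E$ is $\mathcal T_c$-open if for each $x\in G$ there is $\varepsilon\in L^0_{++}(\mathcal F)$ with $\{y\in E:|y-x|\le\varepsilon\}\subset G$. A set $U\subset E$ is $L^0$-convex if $\xi x+(1-\xi)y\in U$ for $x,y\in U$ and $\xi\in L^0(\mathcal F,\mathbb R)$ with $0\le\xi\le1$; $L^0$-balanced if $\eta U\subset U$ for all $\eta\in L^0(\mathcal F,\mathbb R)$ with $|\eta|\le1$; $L^0$-absorbent if for every $x\in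 E$ there is $\xi\in L^0_{++}(\mathcal F)$ with $\eta x\in U$ for all $\eta\in L^0(\mathcal F,\mathbb R)$ with $|\eta|\le\xi$. *)

theory Defs
  imports "HOL-Probability.Probability"
begin

definition ae_eq_rel :: "'a measure \<Rightarrow> (('a \<Rightarrow> real) \<times> ('a \<Rightarrow> real)) set" where
  "ae_eq_rel P = {(f, g). f \<in> borel_measurable P \<and> g \<in> borel_measurable P
                          \<and> (AE w in P. f w = g w)}"

text \<open>The underlying measure is a term and not a type, so the quotient is a set of
  equivalence classes; all notions below are relativised to this carrier.\<close>

definition L0 :: "'a measure \<Rightarrow> ('a \<Rightarrow> real) set set" where
  "L0 P = borel_measurable P // ae_eq_rel P"

definition L0_class :: "'a measure \<Rightarrow> ('a \<Rightarrow> real) \<Rightarrow> ('a \<Rightarrow> real) set" where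
  "L0_class P f = ae_eq_rel P `` {f}"

lemma equiv_ae_eq_rel: "equiv (borel_measurable P) (ae_eq_rel P)"
proof (rule equivI)
  show "ae_eq_rel P \<subseteq> borel_measurable P \<times> borel_measurable P"
    by (auto simp: ae_eq_rel_def)
  show "refl_on (borel_measurable P) (ae_eq_rel P)"
    by (auto simp: refl_on_def ae_eq_rel_def)
  show "sym (ae_eq_rel P)"
    by (auto simp: sym_def ae_eq_rel_def eq_commute)
  show "trans (ae_eq_rel P)"
    unfolding trans_def ae_eq_rel_def by auto
qed

lemma mem_L0_class:
  "f \<in> borel_measurable P \<Longrightarrow>
   g \<in> L0_class P f \<longleftrightarrow> g \<in> borel_measurable P \<and> (AE w in P. f w = g w)"
  by (auto simp: L0_class_def ae_eq_rel_def)

lemma L0_eq_classes: "L0 P = L0_class P ` borel_measurable P"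
  by (auto simp: L0_def L0_class_def quotient_def)

lemma L0_class_eq_iff:
  "f \<in> borel_measurable P \<Longrightarrow> g \<in> borel_measurable P \<Longrightarrow>
   L0_class P f = L0_class P g \<longleftrightarrow> (AE w in P. f w = g w)"
  unfolding L0_class_def eq_equiv_class_iff[OF equiv_ae_eq_rel]
  by (simp add: ae_eq_rel_def)


text \<open>Pointwise operations and relations, lifted to classes through representatives.\<close>

definition L0_map :: "'a measure \<Rightarrow> (real \<Rightarrow> real) \<Rightarrow> ('a \<Rightarrow> real) set \<Rightarrow> ('a \<Rightarrow> real) set" where
  "L0_map P h x = (\<Union>f\<in>x. L0_class P (\<lambda>w. h (f w)))"

definition L0_map2 :: "'a measure \<Rightarrow> (real \<Rightarrow> real \<Rightarrow> real) \<Rightarrow>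
    ('a \<Rightarrow> real) set \<Rightarrow> ('a \<Rightarrow> real) set \<Rightarrow> ('a \<Rightarrow> real) set" where
  "L0_map2 P h x y = (\<Union>f\<in>x. \<Union>g\<in>y. L0_class P (\<lambda>w. h (f w) (g w)))"

definition L0_rel :: "'a measure \<Rightarrow> (real \<Rightarrow> real \<Rightarrow> bool) \<Rightarrow>
    ('a \<Rightarrow> real) set \<Rightarrow> ('a \<Rightarrow> real) set \<Rightarrow> bool" where
  "L0_rel P r x y \<longleftrightarrow> (\<exists>f\<in>x. \<exists>g\<in>y. AE w in P. r (f w) (g w))"

lemma L0_map_class:
  assumes "h \<in> borel_measurable borel" "f \<in> borel_measurable P"
  shows "L0_map P h (L0_class P f) = L0_class P (\<lambda>w. h (f w))"
proof -
  have "L0_class P (\<lambda>w. h (f' w)) = L0_class P (\<lambda>w. h (f w))"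
    if "f' \<in> L0_class P f" for f'
    using that assms by (subst L0_class_eq_iff) (auto simp: mem_L0_class)
  moreover have "f \<in> L0_class P f"
    using assms by (simp add: mem_L0_class)
  ultimately show ?thesis
    unfolding L0_map_def by blast
qed

lemma L0_map2_class:
  assumes h: "(\<lambda>p. h (fst p) (snd p)) \<in> borel_measurable (borel \<Otimes>\<^sub>M borel)"
    and f: "f \<in> borel_measurable P" and g: "g \<in> borel_measurable P"
  shows "L0_map2 P h (L0_class P f) (L0_class P g) = L0_class P (\<lambda>w. h (f w) (g w))"
proof -
  have meas: "(\<lambda>w. h (u w) (v w)) \<in> borel_measurable P"
    if "u \<in> borel_measurable P" "v \<in> borel_measurable P" for u v
    using measurable_compose[OF measurable_Pair[OF that] h] by simp
  have "L0_class P (\<lambda>w. h (f' w) (g' w)) = L0_class P (\<lambda>w. h (f w) (g w))"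
    if "f' \<in> L0_class P f" "g' \<in> L0_class P g" for f' g'
    using that f g by (subst L0_class_eq_iff) (auto simp: mem_L0_class intro!: meas)
  moreover have "f \<in> L0_class P f" "g \<in> L0_class P g"
    using f g by (simp_all add: mem_L0_class)
  ultimately show ?thesis
    unfolding L0_map2_def by blast
qed

lemma L0_rel_class:
  assumes "f \<in> borel_measurable P" "g \<in> borel_measurable P"
  shows "L0_rel P r (L0_class P f) (L0_class P g) \<longleftrightarrow> (AE w in P. r (f w) (g w))"
proof
  assume "L0_rel P r (L0_class P f) (L0_class P g)"
  then obtain f' g' where
    "AE w in P. f w = f' w" "AE w in P. g w = g' w" "AE w in P. r (f' w) (g' w)"
    using assms by (auto simp: L0_rel_def mem_L0_class)
  then show "AE w in P. r (f w) (g w)" by eventually_elim simp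
next
  assume "AE w in P. r (f w) (g w)"
  with assms show "L0_rel P r (L0_class P f) (L0_class P g)"
    unfolding L0_rel_def by (intro bexI[of _ f] bexI[of _ g]) (auto simp: mem_L0_class)
qed

abbreviation L0_const :: "'a measure \<Rightarrow> real \<Rightarrow> ('a \<Rightarrow> real) set" where
  "L0_const P c \<equiv> L0_class P (\<lambda>w. c)"

abbreviation L0_ind :: "'a measure \<Rightarrow> 'a set \<Rightarrow> ('a \<Rightarrow> real) set" where
  "L0_ind P A \<equiv> L0_class P (indicat_real A)"

definition "L0_add P = L0_map2 P (+)"
definition "L0_diff P = L0_map2 P (-)"
definition "L0_mult P = L0_map2 P (*)"
definition "L0_abs P = L0_map P abs"
definition "L0_le P = L0_rel P (\<le>)"

text \<open>Strict inequality is almost sure on the whole space; it is not the strict part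
  of \<^const>\<open>L0_le\<close>.\<close>

definition "L0_lt P = L0_rel P (<)"

definition L0_pp :: "'a measure \<Rightarrow> ('a \<Rightarrow> real) set set" where
  "L0_pp P = {x \<in> L0 P. L0_lt P (L0_const P 0) x}"

definition L0_scale :: "'a measure \<Rightarrow> ('a \<Rightarrow> real) set \<Rightarrow> ('a \<Rightarrow> real) set set \<Rightarrow>
    ('a \<Rightarrow> real) set set" where
  "L0_scale P z S = L0_mult P z ` S"

definition L0_set_add :: "'a measure \<Rightarrow> ('a \<Rightarrow> real) set set \<Rightarrow> ('a \<Rightarrow> real) set set \<Rightarrow>
    ('a \<Rightarrow> real) set set" where
  "L0_set_add P S T = {L0_add P x y | x y. x \<in> S \<and> y \<in> T}"


definition L0_cball :: "'a measure \<Rightarrow> ('a \<Rightarrow> real) set \<Rightarrow> ('a \<Rightarrow> real) set \<Rightarrow>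
    ('a \<Rightarrow> real) set set" where
  "L0_cball P x e = {y \<in> L0 P. L0_le P (L0_abs P (L0_diff P y x)) e}"

definition Tc_open :: "'a measure \<Rightarrow> ('a \<Rightarrow> real) set set \<Rightarrow> bool" where
  "Tc_open P G \<longleftrightarrow> G \<subseteq> L0 P \<and> (\<forall>x\<in>G. \<exists>e\<in>L0_pp P. L0_cball P x e \<subseteq> G)"

definition Tc :: "'a measure \<Rightarrow> ('a \<Rightarrow> real) set topology" where
  "Tc P = topology (Tc_open P)"

lemma L0_le_trans:
  assumes "L0_le P x y" "L0_le P y z" "x \<in> L0 P" "y \<in> L0 P" "z \<in> L0 P"
  shows "L0_le P x z"
proof -
  obtain f g h where *: "f \<in> borel_measurable P" "x = L0_class P f"
    "g \<in> borel_measurable P" "y = L0_class P g"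
    "h \<in> borel_measurable P" "z = L0_class P h"
    using assms(3-5) by (auto simp: L0_eq_classes)
  have "AE w in P. f w \<le> g w" "AE w in P. g w \<le> h w"
    using assms(1,2) * by (auto simp: L0_le_def L0_rel_class)
  then have "AE w in P. f w \<le> h w" by eventually_elim simp
  then show ?thesis using * by (simp add: L0_le_def L0_rel_class)
qed

lemma L0_abs_diff_in:
  assumes "x \<in> L0 P" "y \<in> L0 P"
  shows "L0_abs P (L0_diff P y x) \<in> L0 P"
  using assms by (auto simp: L0_eq_classes L0_abs_def L0_diff_def L0_map2_class L0_map_class)

lemma L0_pp_min:
  assumes "d \<in> L0_pp P" "e \<in> L0_pp P"
  obtains k where "k \<in> L0_pp P" "L0_le P k d" "L0_le P k e"
proof -
  obtain f g where *: "f \<in> borel_measurable P" "d = L0_class P f"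
    "g \<in> borel_measurable P" "e = L0_class P g"
    using assms by (auto simp: L0_pp_def L0_eq_classes)
  have "AE w in P. 0 < f w" "AE w in P. 0 < g w"
    using assms * by (auto simp: L0_pp_def L0_lt_def L0_rel_class)
  then have "AE w in P. 0 < min (f w) (g w)" by eventually_elim simp
  with * show ?thesis
    by (intro that[of "L0_class P (\<lambda>w. min (f w) (g w))"])
       (auto simp: L0_pp_def L0_lt_def L0_le_def L0_rel_class L0_eq_classes)
qed

lemma istopology_Tc_open: "istopology (Tc_open P)"
  unfolding istopology_def
proof (intro conjI allI impI)
  fix S T assume S: "Tc_open P S" and T: "Tc_open P T"
  have "\<exists>k\<in>L0_pp P. L0_cball P x k \<subseteq> S \<inter> T" if "x \<in> S" "x \<in> T" for x
  proof -
    obtain d e where de: "d \<in> L0_pp P" "L0_cball P x d \<subseteq> S" "e \<in> L0_pp P" "L0_cball P x e \<subseteq> T"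
      using S T \<open>x \<in> S\<close> \<open>x \<in> T\<close> by (meson Tc_open_def)
    obtain k where k: "k \<in> L0_pp P" "L0_le P k d" "L0_le P k e"
      using L0_pp_min de by metis
    have "x \<in> L0 P" using S \<open>x \<in> S\<close> by (auto simp: Tc_open_def)
    then have "L0_cball P x k \<subseteq> L0_cball P x d" "L0_cball P x k \<subseteq> L0_cball P x e"
      using k de unfolding L0_cball_def L0_pp_def
      by (auto intro: L0_le_trans L0_abs_diff_in)
    with k de show ?thesis by blast
  qed
  with S T show "Tc_open P (S \<inter> T)" by (auto simp: Tc_open_def)
next
  fix K assume K: "\<forall>S\<in>K. Tc_open P S"
  then have "K \<subseteq> Pow (L0 P)" by (auto simp: Tc_open_def)
  moreover have "\<exists>e\<in>L0_pp P. L0_cball P x e \<subseteq> \<Union>K" if "S \<in> K" "x \<in> S" for x S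
    using K that unfolding Tc_open_def by (meson Union_upper order_trans)
  ultimately show "Tc_open P (\<Union>K)" by (auto simp: Tc_open_def)
qed

lemma openin_Tc: "openin (Tc P) = Tc_open P"
  unfolding Tc_def by (rule topology_inverse'[OF istopology_Tc_open])

lemma topspace_Tc: "topspace (Tc P) = L0 P"
proof -
  have "L0_const P 1 \<in> L0_pp P"
    by (auto simp: L0_pp_def L0_lt_def L0_rel_class L0_eq_classes)
  then have "Tc_open P (L0 P)"
    by (auto simp: Tc_open_def L0_cball_def)
  then show ?thesis
    unfolding topspace_def openin_Tc by (auto simp: Tc_open_def)
qed

definition nbhd_of :: "'b topology \<Rightarrow> 'b \<Rightarrow> 'b set \<Rightarrow> bool" where
  "nbhd_of T x U \<longleftrightarrow> U \<subseteq> topspace T \<and> (\<exists>G. openin T G \<and> x \<in> G \<and> G \<subseteq> U)"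


definition L0_convex :: "'a measure \<Rightarrow> ('a \<Rightarrow> real) set set \<Rightarrow> bool" where
  "L0_convex P U \<longleftrightarrow> U \<subseteq> L0 P \<and>
     (\<forall>x\<in>U. \<forall>y\<in>U. \<forall>z\<in>L0 P. L0_le P (L0_const P 0) z \<and> L0_le P z (L0_const P 1) \<longrightarrow>
        L0_add P (L0_mult P z x) (L0_mult P (L0_diff P (L0_const P 1) z) y) \<in> U)"

definition L0_balanced :: "'a measure \<Rightarrow> ('a \<Rightarrow> real) set set \<Rightarrow> bool" where
  "L0_balanced P U \<longleftrightarrow> U \<subseteq> L0 P \<and>
     (\<forall>z\<in>L0 P. L0_le P (L0_abs P z) (L0_const P 1) \<longrightarrow> L0_scale P z U \<subseteq> U)"

definition L0_absorbent :: "'a measure \<Rightarrow> ('a \<Rightarrow> real) set set \<Rightarrow> bool" where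
  "L0_absorbent P U \<longleftrightarrow> U \<subseteq> L0 P \<and>
     (\<forall>x\<in>L0 P. \<exists>e\<in>L0_pp P. \<forall>z\<in>L0 P. L0_le P (L0_abs P z) e \<longrightarrow> L0_mult P z x \<in> U)"

definition is_atom :: "'a measure \<Rightarrow> 'a set \<Rightarrow> bool" where
  "is_atom P A \<longleftrightarrow> A \<in> sets P \<and> measure P A > 0 \<and>
     (\<forall>B\<in>sets P. B \<subseteq> A \<longrightarrow> measure P B = 0 \<or> measure P B = measure P A)"

definition nonatomic :: "'a measure \<Rightarrow> bool" where
  "nonatomic P \<longleftrightarrow> (\<nexists>A. is_atom P A)"

definition bdd_away :: "'a measure \<Rightarrow> ('a \<Rightarrow> real) set set" where
  "bdd_away P = {x \<in> L0 P. \<exists>m::real. m > 0 \<and> L0_lt P (L0_const P m) x}"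

end

theory Submission
  imports Defs
begin

text \<open>For the first part, the two sets could only meet if some element of $M$ vanished on $A$.
  For the second, $U$ contains a ball $\{|y| \le \varepsilon\}$, and since $\varepsilon > 0$ a.s.,
  some level set $A = \{\varepsilon > m\}$ with $m > 0$ constant has positive probability. Then
  $m \tilde I_A \in U$ agrees on $A$ with $m + 0 \in M + U$.\<close>

lemma L0_mult_class:
  "f \<in> borel_measurable P \<Longrightarrow> g \<in> borel_measurable P \<Longrightarrow>
   L0_mult P (L0_class P f) (L0_class P g) = L0_class P (\<lambda>w. f w * g w)"
  unfolding L0_mult_def by (intro L0_map2_class) auto

lemma L0_add_class:
  "f \<in> borel_measurable P \<Longrightarrow> g \<in> borel_measurable P \<Longrightarrow>
   L0_add P (L0_class P f) (L0_class P g) = L0_class P (\<lambda>w. f w + g w)"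
  unfolding L0_add_def by (intro L0_map2_class) auto

lemma L0_abs_diff_class:
  "f \<in> borel_measurable P \<Longrightarrow> g \<in> borel_measurable P \<Longrightarrow>
   L0_abs P (L0_diff P (L0_class P f) (L0_class P g)) = L0_class P (\<lambda>w. \<bar>f w - g w\<bar>)"
  unfolding L0_abs_def L0_diff_def by (simp add: L0_map2_class L0_map_class)

text \<open>The set where \<open>f\<close> is positive is the countable union of the level sets with
  thresholds \<open>1/(n+1)\<close>. If each of these were null, \<open>f\<close> would be positive
  almost nowhere.\<close>

lemma (in prob_space) level_set_pos:
  assumes [measurable]: "f \<in> borel_measurable M" and pos: "AE w in M. 0 < f w"
  shows "\<exists>m::real. m > 0 \<and> prob {w \<in> space M. m < f w} > 0"
proof (rule ccontr)
  assume none: "\<not> ?thesis"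
  have "prob {w \<in> space M. m < f w} = 0" if "m > 0" for m
    using none that by (metis zero_less_measure_iff)
  \<comment> \<open>Restricting \<open>m\<close> to the values \<open>1/(n+1)\<close> leaves
    countably many null sets, so one exceptional null set serves all \<open>n\<close>. By the
    Archimedean property, every positive value of \<open>f\<close> exceeds one of these
    thresholds.\<close>
  then have "AE w in M. \<not> inverse (real (Suc n)) < f w" for n
    by (subst (asm) prob_eq_0) auto
  then have "AE w in M. \<forall>n. \<not> inverse (real (Suc n)) < f w"
    by (subst AE_all_countable) auto
  with pos have "AE w in M. False"
    by eventually_elim (metis reals_Archimedean)
  then show False by simp
qed

lemma L0_scale_ind_disjoint_bdd_away:
  assumes A: "A \<in> sets P" "measure P A > 0"
  shows "L0_scale P (L0_ind P A) {L0_const P 0} \<inter> L0_scale P (L0_ind P A) (bdd_away P) = {}"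
proof -
  have "L0_mult P (L0_ind P A) (L0_const P 0) \<noteq> L0_mult P (L0_ind P A) x"
    if x: "x \<in> bdd_away P" for x
  proof
    assume eq: "L0_mult P (L0_ind P A) (L0_const P 0) = L0_mult P (L0_ind P A) x"
    obtain f m where f: "f \<in> borel_measurable P" "x = L0_class P f"
      and m: "m > 0" "AE w in P. m < f w"
      using x by (auto simp: bdd_away_def L0_eq_classes L0_lt_def L0_rel_class)
    have "AE w in P. 0 = indicat_real A w * f w"
      using eq f A by (simp add: L0_mult_class L0_class_eq_iff)
    \<comment> \<open>On \<open>A\<close> the equation reads \<open>f w = 0\<close>, which
      contradicts \<open>0 < m < f w\<close>.\<close>
    with m(2) have "AE w in P. w \<notin> A"
      by eventually_elim (use m(1) in \<open>auto simp: indicator_def\<close>)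
    then have "emeasure P A = 0"
      using A(1) sets.sets_into_space by (subst (asm) AE_iff_measurable[of A]) auto
    with A(2) show False by (simp add: measure_def)
  qed
  then show ?thesis by (auto simp: L0_scale_def)
qed

lemma L0_scale_ind_meets_bdd_away_add:
  assumes "prob_space P" and U: "nbhd_of (Tc P) (L0_const P 0) U"
  obtains A where "A \<in> sets P" "measure P A > 0"
    "L0_scale P (L0_ind P A) U \<inter> L0_scale P (L0_ind P A) (L0_set_add P (bdd_away P) U) \<noteq> {}"
proof -
  interpret prob_space P by fact
  \<comment> \<open>The open set inside \<open>U\<close> contains 0, so it supplies both a ball
    around 0 and the membership of 0 itself, used below as the \<open>U\<close>-summand in
    \<open>M + U\<close>.\<close>
  from U obtain e where e: "e \<in> L0_pp P" "L0_cball P (L0_const P 0) e \<subseteq> U"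
    and zero: "L0_const P 0 \<in> U"
    unfolding nbhd_of_def openin_Tc Tc_open_def by (meson subset_iff subset_trans)
  obtain f where f[measurable]: "f \<in> borel_measurable P" and ef: "e = L0_class P f"
    and fpos: "AE w in P. 0 < f w"
    using e(1) by (auto simp: L0_pp_def L0_eq_classes L0_lt_def L0_rel_class)
  obtain m where m: "m > 0" "prob {w \<in> space P. m < f w} > 0"
    using level_set_pos[OF f fpos] by blast
  define A where "A = {w \<in> space P. m < f w}"
  have A[measurable]: "A \<in> sets P" unfolding A_def by measurable
  let ?u = "L0_class P (\<lambda>w. m * indicat_real A w)"
  \<comment> \<open>On \<open>A\<close> the left side is \<open>m\<close>, which lies below
    \<open>f w\<close> by the choice of \<open>A\<close>; off \<open>A\<close> it is 0 and
    \<open>fpos\<close> suffices.\<close>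
  have "AE w in P. \<bar>m * indicat_real A w - 0\<bar> \<le> f w"
    using fpos by eventually_elim (use m(1) in \<open>auto simp: indicator_def A_def\<close>)
  then have "?u \<in> L0_cball P (L0_const P 0) e"
    unfolding L0_cball_def ef L0_le_def by (simp add: L0_abs_diff_class L0_rel_class L0_eq_classes)
  with e(2) have u: "?u \<in> U" by blast
  \<comment> \<open>The bound in \<open>bdd_away\<close> is strict, so \<open>m / 2\<close> serves
    as the witness rather than \<open>m\<close>.\<close>
  have "L0_const P m \<in> bdd_away P"
    using m(1) by (auto simp: bdd_away_def L0_eq_classes L0_lt_def L0_rel_class
        intro!: exI[of _ "m / 2"])
  with zero have v: "L0_add P (L0_const P m) (L0_const P 0) \<in> L0_set_add P (bdd_away P) U"
    by (auto simp: L0_set_add_def)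
  \<comment> \<open>Both products are the class of \<open>m\<close> times the indicator of
    \<open>A\<close>, as the indicator is idempotent.\<close>
  have "L0_mult P (L0_ind P A) ?u
      = L0_mult P (L0_ind P A) (L0_add P (L0_const P m) (L0_const P 0))"
    by (simp add: L0_mult_class L0_add_class L0_class_eq_iff indicator_def)
  with u v have "L0_scale P (L0_ind P A) U
      \<inter> L0_scale P (L0_ind P A) (L0_set_add P (bdd_away P) U) \<noteq> {}"
    unfolding L0_scale_def by blast
  with A m(2) show thesis by (intro that[of A]) (simp_all add: A_def)
qed

theorem claim3p4:
  fixes P :: "'a measure"
  assumes "prob_space P" and "nonatomic P"
  shows "(\<forall>A\<in>sets P. measure P A > 0 \<longrightarrow>
            L0_scale P (L0_ind P A) {L0_const P 0} \<inter> L0_scale P (L0_ind P A) (bdd_away P) = {})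
       \<and> (\<forall>U. L0_convex P U \<and> L0_absorbent P U \<and> L0_balanced P U
              \<and> nbhd_of (Tc P) (L0_const P 0) U \<longrightarrow>
            (\<exists>A\<in>sets P. measure P A > 0 \<and>
               L0_scale P (L0_ind P A) U
                 \<inter> L0_scale P (L0_ind P A) (L0_set_add P (bdd_away P) U) \<noteq> {}))"
  using L0_scale_ind_disjoint_bdd_away L0_scale_ind_meets_bdd_away_add[OF assms(1)] by metis

end
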